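(* Let $\gamma>0$, let $n$ be a positive integer, let $g_1,\dots,g_n,h_1,\dots,h_n\in\mathcal{H}_\gamma(\mathbb{D})$, and let $T_n$ be the finite-rank operator on $\mathcal{H}_\gamma(\mathbb{D})$ given by $T_n(f)=\sum_{i=1}^{n}\langle f,g_i\rangle h_i$ for $f\in\mathcal{H}_\gamma(\mathbb{D})$. If all the functions $g_i$ and $h_i$ have power series representations about the origin with real coefficients, then the Berezin range $\mathrm{Ber}(T_n)$ is closed under complex conjugation, and hence is symmetric with respect to the real axis.
   Context: $\mathbb{D}$ is the open unit disc in $\mathbb{C}$. For $\gamma>0$, $\mathcal{H}_\gamma(\mathbb{D})$ is the reproducing kernel Hilbert space of holomorphic functions on $\mathbb{D}$ with reproducing kernel $k_\lambda(z)=(1-\overline{\lambda}z)^{-\gamma}$ for $\lambda,z\in\mathbb{D}$ (principal branch), so $\langle f,k_\lambda\rangle=f(\lambda)$ and $\|k_\lambda\|^2=(1-|\lambda|^2)^{-\gamma}$. Put $\widehat{k}_\lambda=k_\lambda/\|k_\lambda\|$. For a bounded linear operator $T$ on $\mathcal{H}_\gamma(\mathbb{D})$, the Berezin transform is $\widetilde{T}(\lambda)=\langle T\widehat{k}_\lambda,\widehat{k}_\lambda\rangle$ for $\lambda\in\mathbb{D}$, and the Berezin range is $\mathrm{Ber}(T)=\{\widetilde{T}(\lambda):\lambda\in\mathbb{D}\}\subseteq\mathbb{C}$. *)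

theory Defs
  imports "HOL-Complex_Analysis.Complex_Analysis"
begin

text \<open>
  A function on a domain \<open>D\<close> is represented by a total function that vanishes outside \<open>D\<close>, so that
  equality of functions on \<open>D\<close> is HOL equality. Inner products are linear in the first argument.
\<close>

definition ip_norm :: "('f \<Rightarrow> 'f \<Rightarrow> complex) \<Rightarrow> 'f \<Rightarrow> real" where
  "ip_norm ip f = sqrt (Re (ip f f))"

locale hilbert_function_space =
  fixes D :: "complex set"
    and H :: "(complex \<Rightarrow> complex) set"
    and ip :: "(complex \<Rightarrow> complex) \<Rightarrow> (complex \<Rightarrow> complex) \<Rightarrow> complex"
  assumes zero_outside: "f \<in> H \<Longrightarrow> z \<notin> D \<Longrightarrow> f z = 0"
    and zero_mem: "(\<lambda>z. 0) \<in> H"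
    and add_mem: "f \<in> H \<Longrightarrow> g \<in> H \<Longrightarrow> (\<lambda>z. f z + g z) \<in> H"
    and scale_mem: "f \<in> H \<Longrightarrow> (\<lambda>z. c * f z) \<in> H"
    and ip_add_left: "f \<in> H \<Longrightarrow> g \<in> H \<Longrightarrow> u \<in> H \<Longrightarrow> ip (\<lambda>z. f z + g z) u = ip f u + ip g u"
    and ip_scale_left: "f \<in> H \<Longrightarrow> u \<in> H \<Longrightarrow> ip (\<lambda>z. c * f z) u = c * ip f u"
    and ip_commute: "f \<in> H \<Longrightarrow> g \<in> H \<Longrightarrow> ip f g = cnj (ip g f)"
    and ip_nonneg: "f \<in> H \<Longrightarrow> 0 \<le> Re (ip f f)"
    and ip_definite: "f \<in> H \<Longrightarrow> ip f f = 0 \<Longrightarrow> f = (\<lambda>z. 0)"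
    and complete:
      "(\<And>m. F m \<in> H) \<Longrightarrow>
       (\<forall>e>0. \<exists>N. \<forall>m\<ge>N. \<forall>n\<ge>N. ip_norm ip (\<lambda>z. F m z - F n z) < e) \<Longrightarrow>
       \<exists>f\<in>H. (\<lambda>m. ip_norm ip (\<lambda>z. F m z - f z)) \<longlonglongrightarrow> 0"

locale reproducing_kernel_hilbert_space = hilbert_function_space D H ip
  for D :: "complex set" and H :: "(complex \<Rightarrow> complex) set"
    and ip :: "(complex \<Rightarrow> complex) \<Rightarrow> (complex \<Rightarrow> complex) \<Rightarrow> complex" +
  fixes k :: "complex \<Rightarrow> complex \<Rightarrow> complex"
  assumes kernel_mem: "l \<in> D \<Longrightarrow> k l \<in> H"
    and reproducing: "f \<in> H \<Longrightarrow> l \<in> D \<Longrightarrow> ip f (k l) = f l"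

abbreviation unit_disc :: "complex set" where
  "unit_disc \<equiv> ball 0 1"

text \<open>
  The real part of \<open>1 - cnj l * z\<close> is positive for \<open>l\<close>, \<open>z\<close> in the unit disc, so \<open>powr\<close> is the
  principal branch there.
\<close>

definition disc_kernel :: "real \<Rightarrow> complex \<Rightarrow> complex \<Rightarrow> complex" where
  "disc_kernel \<gamma> l z =
     (if z \<in> unit_disc then (1 - cnj l * z) powr (- complex_of_real \<gamma>) else 0)"

text \<open>
  The pair \<open>(H, ip)\<close> is the space $\mathcal{H}_\gamma(\mathbb{D})$ with its inner product. A Hilbert
  space of functions is determined by its reproducing kernel (Moore--Aronszajn), so at most one such
  set \<open>H\<close> exists, and \<open>ip\<close> is unique on it.
\<close>

locale H_gamma =
  reproducing_kernel_hilbert_space unit_disc H ip "disc_kernel \<gamma>"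
  for \<gamma> :: real and H :: "(complex \<Rightarrow> complex) set"
    and ip :: "(complex \<Rightarrow> complex) \<Rightarrow> (complex \<Rightarrow> complex) \<Rightarrow> complex" +
  assumes gamma_pos: "0 < \<gamma>"
    and holomorphic: "f \<in> H \<Longrightarrow> f holomorphic_on unit_disc"

definition normalized_kernel ::
    "real \<Rightarrow> ((complex \<Rightarrow> complex) \<Rightarrow> (complex \<Rightarrow> complex) \<Rightarrow> complex) \<Rightarrow>
     complex \<Rightarrow> complex \<Rightarrow> complex" where
  "normalized_kernel \<gamma> ip l =
     (\<lambda>z. disc_kernel \<gamma> l z / complex_of_real (ip_norm ip (disc_kernel \<gamma> l)))"

definition berezin_transform ::
    "real \<Rightarrow> ((complex \<Rightarrow> complex) \<Rightarrow> (complex \<Rightarrow> complex) \<Rightarrow> complex) \<Rightarrow>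
     ((complex \<Rightarrow> complex) \<Rightarrow> (complex \<Rightarrow> complex)) \<Rightarrow> complex \<Rightarrow> complex" where
  "berezin_transform \<gamma> ip T l = ip (T (normalized_kernel \<gamma> ip l)) (normalized_kernel \<gamma> ip l)"

definition berezin_range ::
    "real \<Rightarrow> ((complex \<Rightarrow> complex) \<Rightarrow> (complex \<Rightarrow> complex) \<Rightarrow> complex) \<Rightarrow>
     ((complex \<Rightarrow> complex) \<Rightarrow> (complex \<Rightarrow> complex)) \<Rightarrow> complex set" where
  "berezin_range \<gamma> ip T = berezin_transform \<gamma> ip T ` unit_disc"

definition finite_rank_operator ::
    "((complex \<Rightarrow> complex) \<Rightarrow> (complex \<Rightarrow> complex) \<Rightarrow> complex) \<Rightarrow> nat \<Rightarrow>
     (nat \<Rightarrow> complex \<Rightarrow> complex) \<Rightarrow> (nat \<Rightarrow> complex \<Rightarrow> complex) \<Rightarrow>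
     (complex \<Rightarrow> complex) \<Rightarrow> complex \<Rightarrow> complex" where
  "finite_rank_operator ip n g h f = (\<lambda>z. \<Sum>i=1..n. ip f (g i) * h i z)"

definition has_real_power_series :: "(complex \<Rightarrow> complex) \<Rightarrow> bool" where
  "has_real_power_series f \<longleftrightarrow>
     (\<exists>a :: nat \<Rightarrow> real. \<forall>z\<in>unit_disc. (\<lambda>j. complex_of_real (a j) * z ^ j) sums f z)"

end

theory Submission
  imports Defs
begin

text \<open>The reproducing property turns the Berezin transform of the operator at \<open>l\<close>
  into the sum of \<open>cnj (g i l) * h i l\<close> divided by the squared norm of the kernel at
  \<open>l\<close> (\<open>berezin_transform_finite_rank\<close>). Real Taylor coefficients make
  every \<open>g i\<close> and \<open>h i\<close> commute with conjugation
  (\<open>has_real_power_series_cnj\<close>), and the kernels at \<open>l\<close> and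
  \<open>cnj l\<close> have equal norms (\<open>ip_norm_disc_kernel_cnj\<close>). Hence the
  transform at \<open>cnj l\<close> is the conjugate of the transform at \<open>l\<close>. Since the
  disc is invariant under conjugation, so is the range.\<close>

text \<open>Conjugating the series term by term fixes the real coefficients and replaces
  \<open>z\<close> by \<open>cnj z\<close>; uniqueness of sums identifies the two limits.\<close>

lemma has_real_power_series_cnj:
  assumes "has_real_power_series f" and "z \<in> unit_disc"
  shows "f (cnj z) = cnj (f z)"
proof -
  obtain a :: "nat \<Rightarrow> real"
    where a: "\<And>z. z \<in> unit_disc \<Longrightarrow> (\<lambda>j. complex_of_real (a j) * z ^ j) sums f z"
    using assms(1) unfolding has_real_power_series_def by blast
  have "(\<lambda>j. cnj (complex_of_real (a j) * z ^ j)) sums cnj (f z)"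
    using a[OF assms(2)] by (simp only: sums_cnj)
  then have "(\<lambda>j. complex_of_real (a j) * cnj z ^ j) sums cnj (f z)"
    by simp
  moreover have "cnj z \<in> unit_disc"
    using assms(2) by simp
  ultimately show ?thesis
    using a[of "cnj z"] by (blast intro: sums_unique2)
qed

lemma (in hilbert_function_space) sum_mem:
  assumes "finite I" and "\<And>i. i \<in> I \<Longrightarrow> f i \<in> H"
  shows "(\<lambda>z. \<Sum>i\<in>I. c i * f i z) \<in> H"
  using assms
proof (induction I rule: finite_induct)
  case empty
  then show ?case by (simp add: zero_mem)
next
  case (insert i I)
  then show ?case by (simp add: add_mem scale_mem)
qed

lemma (in hilbert_function_space) ip_scale_right:
  assumes "f \<in> H" and "u \<in> H"
  shows "ip f (\<lambda>z. c * u z) = cnj c * ip f u"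
  using ip_commute[OF assms(1) scale_mem[OF assms(2)]] ip_commute[OF assms]
  by (simp add: ip_scale_left assms)

context H_gamma
begin

text \<open>The normalizing factor is real, so conjugate-linearity in the second slot pulls it out
  unchanged, and the rest is point evaluation.\<close>

lemma ip_normalized_kernel:
  assumes "f \<in> H" and "l \<in> unit_disc"
  shows "ip f (normalized_kernel \<gamma> ip l) = f l / complex_of_real (ip_norm ip (disc_kernel \<gamma> l))"
  using ip_scale_right[OF assms(1) kernel_mem[OF assms(2)],
      of "inverse (complex_of_real (ip_norm ip (disc_kernel \<gamma> l)))"]
  by (simp add: normalized_kernel_def reproducing[OF assms] divide_inverse mult.commute)

lemma normalized_kernel_mem:
  assumes "l \<in> unit_disc"
  shows "normalized_kernel \<gamma> ip l \<in> H"
  using scale_mem[OF kernel_mem[OF assms],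
      of "inverse (complex_of_real (ip_norm ip (disc_kernel \<gamma> l)))"]
  by (simp add: normalized_kernel_def divide_inverse mult.commute)

lemma berezin_transform_finite_rank:
  assumes l: "l \<in> unit_disc"
    and gH: "\<And>i. i \<in> {1..n} \<Longrightarrow> g i \<in> H" and hH: "\<And>i. i \<in> {1..n} \<Longrightarrow> h i \<in> H"
  shows "berezin_transform \<gamma> ip (finite_rank_operator ip n g h) l =
    (\<Sum>i=1..n. cnj (g i l) * h i l) / complex_of_real ((ip_norm ip (disc_kernel \<gamma> l))\<^sup>2)"
proof -
  let ?k = "normalized_kernel \<gamma> ip l"
  let ?N = "complex_of_real (ip_norm ip (disc_kernel \<gamma> l))"
  \<comment> \<open>Here the kernel stands in the first slot, so conjugate symmetry comes before
    evaluation. This gives one factor \<open>1 / ?N\<close>; the outer inner product gives the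
    other.\<close>
  have g: "ip ?k (g i) = cnj (g i l) / ?N" if "i \<in> {1..n}" for i
    using ip_commute[OF normalized_kernel_mem[OF l] gH[OF that]]
    by (simp add: ip_normalized_kernel[OF gH[OF that] l])
  have "finite_rank_operator ip n g h ?k \<in> H"
    unfolding finite_rank_operator_def by (rule sum_mem) (auto intro: hH)
  then have "berezin_transform \<gamma> ip (finite_rank_operator ip n g h) l
      = (\<Sum>i=1..n. ip ?k (g i) * h i l) / ?N"
    using l by (simp add: berezin_transform_def ip_normalized_kernel finite_rank_operator_def)
  also have "(\<Sum>i=1..n. ip ?k (g i) * h i l) = (\<Sum>i=1..n. cnj (g i l) * h i l) / ?N"
    by (simp add: g sum_divide_distrib)
  finally show ?thesis
    by (simp add: power2_eq_square)
qed

text \<open>The squared norm is the kernel at \<open>l\<close> evaluated at \<open>l\<close>, a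
  power of \<open>1 - cnj l * l\<close>, and this base is symmetric in \<open>l\<close> and
  \<open>cnj l\<close>.\<close>

lemma ip_norm_disc_kernel_cnj:
  assumes "l \<in> unit_disc"
  shows "ip_norm ip (disc_kernel \<gamma> (cnj l)) = ip_norm ip (disc_kernel \<gamma> l)"
proof -
  have "cnj l \<in> unit_disc"
    using assms by simp
  then show ?thesis
    using assms
    by (simp add: ip_norm_def reproducing kernel_mem disc_kernel_def mult.commute)
qed

lemma berezin_transform_finite_rank_cnj:
  assumes l: "l \<in> unit_disc"
    and gH: "\<And>i. i \<in> {1..n} \<Longrightarrow> g i \<in> H" and hH: "\<And>i. i \<in> {1..n} \<Longrightarrow> h i \<in> H"
    and gr: "\<And>i. i \<in> {1..n} \<Longrightarrow> has_real_power_series (g i)"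
    and hr: "\<And>i. i \<in> {1..n} \<Longrightarrow> has_real_power_series (h i)"
  shows "berezin_transform \<gamma> ip (finite_rank_operator ip n g h) (cnj l) =
    cnj (berezin_transform \<gamma> ip (finite_rank_operator ip n g h) l)"
proof -
  have l': "cnj l \<in> unit_disc"
    using l by simp
  \<comment> \<open>Both sides reduce to the sum of \<open>g i l * cnj (h i l)\<close>.\<close>
  have "(\<Sum>i=1..n. cnj (g i (cnj l)) * h i (cnj l)) = cnj (\<Sum>i=1..n. cnj (g i l) * h i l)"
    unfolding cnj_sum
    by (rule sum.cong) (simp_all add: has_real_power_series_cnj[OF gr l]
        has_real_power_series_cnj[OF hr l])
  \<comment> \<open>Stated for arbitrary \<open>m\<close> so that it rewrites the transform at both
    \<open>l\<close> and \<open>cnj l\<close>.\<close>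
  moreover have "berezin_transform \<gamma> ip (finite_rank_operator ip n g h) m =
    (\<Sum>i=1..n. cnj (g i m) * h i m) / complex_of_real ((ip_norm ip (disc_kernel \<gamma> m))\<^sup>2)"
    if "m \<in> unit_disc" for m
    by (rule berezin_transform_finite_rank) (use that gH hH in auto)
  ultimately show ?thesis
    by (simp only: l l' ip_norm_disc_kernel_cnj complex_cnj_divide complex_cnj_complex_of_real)
qed

end

theorem theorem3p6:
  fixes \<gamma> :: real and n :: nat
    and H :: "(complex \<Rightarrow> complex) set"
    and ip :: "(complex \<Rightarrow> complex) \<Rightarrow> (complex \<Rightarrow> complex) \<Rightarrow> complex"
    and g h :: "nat \<Rightarrow> complex \<Rightarrow> complex"
  assumes "\<gamma> > 0" and "n \<ge> 1"
    and "H_gamma \<gamma> H ip"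
    and "\<And>i. i \<in> {1..n} \<Longrightarrow> g i \<in> H"
    and "\<And>i. i \<in> {1..n} \<Longrightarrow> h i \<in> H"
    and "\<And>i. i \<in> {1..n} \<Longrightarrow> has_real_power_series (g i)"
    and "\<And>i. i \<in> {1..n} \<Longrightarrow> has_real_power_series (h i)"
  shows "(\<forall>w \<in> berezin_range \<gamma> ip (finite_rank_operator ip n g h).
            cnj w \<in> berezin_range \<gamma> ip (finite_rank_operator ip n g h))
         \<and> cnj ` berezin_range \<gamma> ip (finite_rank_operator ip n g h)
             = berezin_range \<gamma> ip (finite_rank_operator ip n g h)"
proof -
  interpret H_gamma \<gamma> H ip by fact
  let ?B = "berezin_range \<gamma> ip (finite_rank_operator ip n g h)"
  have closed: "cnj w \<in> ?B" if wB: "w \<in> ?B" for w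
  proof -
    obtain l where l: "l \<in> unit_disc"
      and w: "w = berezin_transform \<gamma> ip (finite_rank_operator ip n g h) l"
      using wB unfolding berezin_range_def by blast
    have "cnj w = berezin_transform \<gamma> ip (finite_rank_operator ip n g h) (cnj l)"
      unfolding w by (rule berezin_transform_finite_rank_cnj[symmetric]) (use l assms in auto)
    moreover have "cnj l \<in> unit_disc"
      using l by simp
    ultimately show ?thesis
      unfolding berezin_range_def by blast
  qed
  \<comment> \<open>Conjugation is an involution, so each \<open>w\<close> is the conjugate of
    \<open>cnj w\<close>, which lies in \<open>?B\<close> by \<open>closed\<close>.\<close>
  moreover have "?B \<subseteq> cnj ` ?B"
    using closed by (metis complex_cnj_cnj image_eqI subsetI)
  ultimately show ?thesis
    by blast
qed

end
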